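(* Let $H\in\mathbb{C}^{N\times N}$ be Hermitian negative definite with eigenvalues $\lambda_1\le\lambda_2\le\dots\le\lambda_N<0$. Let $\alpha\in(0,1)$ and suppose $\lambda_m<\lambda_{m+1}$. Then there exists $\mu_0(\alpha)>0$ such that for all $0<\mu<\mu_0(\alpha)$, $$d(S_\mu,S_0)\le\frac{\mu\sqrt{Nm}}{\alpha(\lambda_{m+1}-\lambda_m)}.$$
   Context: $N,m$ are positive integers with $m<N$ (so that $\lambda_{m+1}$ makes sense), and eigenvalues are listed with multiplicity. For $X\in\mathbb{C}^{N\times m}$, $E_0(X)=\operatorname{tr}\bigl[(2I-X^*X)X^*HX\bigr]$, where $X^*$ is the conjugate transpose, and for $\mu\ge0$, $E_\mu(X)=E_0(X)+\mu\sum_{i,j}|X_{ij}|$. The set $S_\mu$ is the set of all global minimizers of $E_\mu$ over $\mathbb{C}^{N\times m}$ (with $S_0$ the set of global minimizers of $E_0$). For sets $A,B\subset\mathbb{C}^{N\times m}$, $d(A,B)=\sup_{a\in A}\inf_{b\in B}\|a-b\|_F$, where $\|\cdot\|_F$ is the Frobenius norm. The threshold $\mu_0(\alpha)$ may depend on $H$, $N$, $m$ and $\alpha$. *)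

theory Defs
  imports "HOL-Analysis.Analysis" "HOL-Computational_Algebra.Polynomial"
begin

text \<open>
  An \<open>N \<times> m\<close> complex matrix is an element of \<open>complex ^ 'm ^ 'n\<close> with \<open>N = CARD('n)\<close> and
  \<open>m = CARD('m)\<close>. The norm that the type class \<open>real_normed_vector\<close> gives to
  \<open>complex ^ 'm ^ 'n\<close> is the \<open>L2\<close>-norm of the \<open>L2\<close>-norms of the rows, i.e. the Frobenius norm.
\<close>

definition conj_transpose :: "complex ^ 'm ^ 'n \<Rightarrow> complex ^ 'n ^ 'm" where
  "conj_transpose A = (\<chi> i j. cnj (A $ j $ i))"

definition hermitian :: "complex ^ 'n ^ 'n \<Rightarrow> bool" where
  "hermitian A \<longleftrightarrow> conj_transpose A = A"

text \<open>
  The quadratic form of a Hermitian matrix is real-valued, so taking the real part in the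
  definition below loses nothing.
\<close>

definition hermitian_neg_def :: "complex ^ 'n ^ 'n \<Rightarrow> bool" where
  "hermitian_neg_def A \<longleftrightarrow>
     hermitian A \<and> (\<forall>x. x \<noteq> 0 \<longrightarrow> Re (\<Sum>i\<in>UNIV. cnj (x $ i) * (A *v x) $ i) < 0)"

definition charpoly :: "complex ^ 'n ^ 'n \<Rightarrow> complex poly" where
  "charpoly A = det (\<chi> i j. (if i = j then [:0, 1:] else 0) - [:A $ i $ j:])"

text \<open>
  \<open>lam 1 \<le> \<dots> \<le> lam N\<close> are all the eigenvalues of \<open>A\<close>, listed with (algebraic) multiplicity;
  the values of \<open>lam\<close> outside \<open>{1..N}\<close> are irrelevant.
\<close>

definition ordered_eigenvalues :: "complex ^ 'n ^ 'n \<Rightarrow> (nat \<Rightarrow> real) \<Rightarrow> bool" where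
  "ordered_eigenvalues A lam \<longleftrightarrow>
     mono_on {1..CARD('n)} lam \<and>
     charpoly A = (\<Prod>k = 1..CARD('n). [:- complex_of_real (lam k), 1:])"

text \<open>
  For Hermitian \<open>H\<close> the trace below is a real number; \<open>Re\<close> only turns it into one of type
  \<open>real\<close>. The matrix \<open>mat 2\<close> is \<open>2 I\<close>.
\<close>

definition energy0 :: "complex ^ 'n ^ 'n \<Rightarrow> complex ^ 'm ^ 'n \<Rightarrow> real" where
  "energy0 H X =
     Re (trace ((mat 2 - conj_transpose X ** X) ** (conj_transpose X ** H ** X)))"

definition energy :: "complex ^ 'n ^ 'n \<Rightarrow> real \<Rightarrow> complex ^ 'm ^ 'n \<Rightarrow> real" where
  "energy H mu X = energy0 H X + mu * (\<Sum>i\<in>UNIV. \<Sum>j\<in>UNIV. cmod (X $ i $ j))"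

definition minimizers :: "complex ^ 'n ^ 'n \<Rightarrow> real \<Rightarrow> (complex ^ 'm ^ 'n) set" where
  "minimizers H mu = {X. \<forall>Y :: complex ^ 'm ^ 'n. energy H mu X \<le> energy H mu Y}"

text \<open>
  Extended reals make the supremum and the infimum meaningful without any side condition on
  boundedness or nonemptiness.
\<close>

definition set_deviation :: "'a::real_normed_vector set \<Rightarrow> 'a set \<Rightarrow> ereal" where
  "set_deviation A B = (SUP a\<in>A. INF b\<in>B. ereal (norm (a - b)))"

end

theory Submission
  imports Defs
begin

text \<open>
  Write \<open>g = lam (m + 1) - lam m\<close>, let \<open>J\<close> be the set of the \<open>m\<close> lowest eigendirections of \<open>H\<close>,
  and let \<open>e\<close> be the sum of the \<open>m\<close> lowest eigenvalues. After a unitary change of basis on both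
  sides, \<open>H\<close> is diagonal with entries \<open>k i\<close> and \<open>X\<close> has orthogonal columns \<open>s\<^sub>j u\<^sub>j\<close>. With
  \<open>a\<^sub>j = - \<langle>u\<^sub>j, H u\<^sub>j\<rangle>\<close>, completing the square gives
  \<open>E\<^sub>0 X - e = (- e - \<Sum>\<^sub>j a\<^sub>j) + \<Sum>\<^sub>j (1 - s\<^sub>j\<^sup>2)\<^sup>2 a\<^sub>j\<close>,
  and by Bessel's inequality the bracket is at least \<open>g t\<close>, where \<open>t\<close> is \<open>m\<close> minus the squared norm
  of the \<open>J\<close>-rows of \<open>u\<close>. So \<open>e\<close> is the minimum of \<open>E\<^sub>0\<close>; and when \<open>E\<^sub>0 X - e\<close> is small, then \<open>t\<close>
  and all \<open>1 - s\<^sub>j\<close> are small and the polar factor \<open>Y\<close> of the \<open>J\<close>-rows is a minimizer with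
  \<open>\<alpha> g \<parallel>X - Y\<parallel>\<^sup>2 \<le> E\<^sub>0 X - e\<close>.

  If \<open>X\<close> minimizes \<open>E\<^sub>\<mu>\<close>, then \<open>E\<^sub>0 X - e \<le> \<mu> (\<parallel>Y\<parallel>\<^sub>1 - \<parallel>X\<parallel>\<^sub>1)\<close> for every minimizer \<open>Y\<close> of \<open>E\<^sub>0\<close>.
  With a fixed \<open>Y\<close> this makes the left side small; with the \<open>Y\<close> found above, the right side is at
  most \<open>\<mu> sqrt (N m) \<parallel>X - Y\<parallel>\<close>, and dividing by \<open>\<parallel>X - Y\<parallel>\<close> gives the bound.
\<close>

subsection \<open>Isometries and diagonalization of Hermitian matrices\<close>

definition diagonal :: "('a \<Rightarrow> real) \<Rightarrow> complex ^ 'a ^ 'a" where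
  "diagonal d = (\<chi> i j. if i = j then complex_of_real (d i) else 0)"

text \<open>The rectangular form covers the normalized \<open>X\<close> as well as the unitary base
  changes, which are its square case.\<close>

definition isometry :: "complex ^ 'm ^ 'n \<Rightarrow> bool" where
  "isometry W \<longleftrightarrow> conj_transpose W ** W = mat 1"

lemma conj_transpose_mult: "conj_transpose (A ** B) = conj_transpose B ** conj_transpose A"
  for A :: "complex ^ 'm ^ 'n"
  by (simp add: conj_transpose_def matrix_matrix_mult_def vec_eq_iff mult.commute)

lemma conj_transpose_conj_transpose [simp]: "conj_transpose (conj_transpose A) = A"
  by (simp add: conj_transpose_def vec_eq_iff)

lemma conj_transpose_mat_1 [simp]: "conj_transpose (mat 1) = mat 1"
  by (simp add: conj_transpose_def vec_eq_iff mat_def)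

lemma conj_transpose_diagonal [simp]: "conj_transpose (diagonal d) = diagonal d"
  by (simp add: conj_transpose_def vec_eq_iff diagonal_def)

lemma matrix_mult_diagonal_nth: "(A ** diagonal d) $ i $ j = A $ i $ j * complex_of_real (d j)"
  for A :: "complex ^ 'm ^ 'n"
  by (simp add: diagonal_def matrix_matrix_mult_def if_distrib if_distribR cong: if_cong)

lemma diagonal_mult_matrix_nth: "(diagonal d ** A) $ i $ j = complex_of_real (d i) * A $ i $ j"
  for A :: "complex ^ 'm ^ 'n"
  by (simp add: diagonal_def matrix_matrix_mult_def if_distrib if_distribR cong: if_cong)

lemma diagonal_mult_diagonal: "diagonal c ** diagonal d = diagonal (\<lambda>i. c i * d i)"
  by (simp add: vec_eq_iff matrix_mult_diagonal_nth) (simp add: diagonal_def)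

lemma gram_nth:
  "(conj_transpose A ** B) $ i $ j = (\<Sum>k\<in>UNIV. cnj (A $ k $ i) * B $ k $ j)"
  for A :: "complex ^ 'm ^ 'n" and B :: "complex ^ 'l ^ 'n"
  by (simp add: conj_transpose_def matrix_matrix_mult_def)

lemma hermitian_gram: "hermitian (conj_transpose A ** A)" for A :: "complex ^ 'm ^ 'n"
  by (simp add: hermitian_def conj_transpose_mult)

lemma isometry_right_inverse:
  "isometry W \<Longrightarrow> W ** conj_transpose W = mat 1" for W :: "complex ^ 'n ^ 'n"
  unfolding isometry_def using matrix_left_right_inverse by blast

lemma isometry_conj_transpose: "isometry W \<Longrightarrow> isometry (conj_transpose W)"
  for W :: "complex ^ 'n ^ 'n"
  by (simp add: isometry_def isometry_right_inverse[unfolded isometry_def])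

lemma isometry_mult: "isometry A \<Longrightarrow> isometry B \<Longrightarrow> isometry (A ** B)"
  for A :: "complex ^ 'm ^ 'n"
proof -
  assume A: "isometry A" and B: "isometry B"
  have "conj_transpose (A ** B) ** (A ** B) = conj_transpose B ** (conj_transpose A ** A) ** B"
    by (simp only: conj_transpose_mult matrix_mul_assoc)
  then show ?thesis using A B by (simp add: isometry_def)
qed

lemma inner_complex_vec: "x \<bullet> y = Re (\<Sum>i\<in>UNIV. cnj (x $ i) * y $ i)" for x :: "complex ^ 'n"
  by (simp add: inner_vec_def inner_complex_def)

text \<open>The complex form is stated because \<open>\<bullet>\<close> is only its real part:
  symmetry uses the real part, while invariance of a complex orthogonal complement uses the whole
  value.\<close>

lemma hermitian_adjoint:
  fixes A :: "complex ^ 'n ^ 'n"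
  assumes "hermitian A"
  shows "(\<Sum>i\<in>UNIV. cnj (x $ i) * (A *v y) $ i) = (\<Sum>i\<in>UNIV. cnj ((A *v x) $ i) * y $ i)"
proof -
  have A: "cnj (A $ i $ j) = A $ j $ i" for i j
    using assms by (simp add: hermitian_def conj_transpose_def vec_eq_iff) 
  have "(\<Sum>i\<in>UNIV. cnj (x $ i) * (A *v y) $ i) = (\<Sum>i\<in>UNIV. \<Sum>j\<in>UNIV. cnj (x $ i) * A $ i $ j * y $ j)"
    by (simp add: matrix_vector_mult_def sum_distrib_left mult.assoc)
  also have "\<dots> = (\<Sum>j\<in>UNIV. \<Sum>i\<in>UNIV. cnj (x $ i) * A $ i $ j * y $ j)"
    by (rule sum.swap)
  also have "\<dots> = (\<Sum>i\<in>UNIV. cnj ((A *v x) $ i) * y $ i)"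
    by (simp add: matrix_vector_mult_def sum_distrib_left sum_distrib_right A ac_simps)
  finally show ?thesis .
qed

text \<open>A maximizer of the Rayleigh quotient on the unit sphere of the subspace is an eigenvector.\<close>
lemma hermitian_eigenvector_in_subspace:
  fixes A :: "complex ^ 'n ^ 'n"
  assumes A: "hermitian A" and S: "subspace S"
    and inv: "\<And>x. x \<in> S \<Longrightarrow> A *v x \<in> S" and nz: "\<exists>x\<in>S. x \<noteq> 0"
  shows "\<exists>x\<in>S. \<exists>l::real. norm x = 1 \<and> A *v x = l *\<^sub>R x"
proof -
  obtain y where y: "y \<in> S" "y \<noteq> 0" using nz by blast
  define f where "f x = x \<bullet> (A *v x)" for x
  have lin: "bounded_linear ((*v) A)"
    by (rule linear_conv_bounded_linear[THEN iffD1], rule linearI)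
      (simp_all add: matrix_vector_right_distrib matrix_vector_mult_def vec_eq_iff sum.distrib algebra_simps scaleR_sum_right)
  have sym: "x \<bullet> (A *v z) = (A *v x) \<bullet> z" for x z
    using hermitian_adjoint[OF A, of x z] by (simp add: inner_complex_vec)
  have "compact (sphere 0 1 \<inter> S)"
    using S by (intro compact_Int_closed closed_subspace) auto
  moreover have "y /\<^sub>R norm y \<in> sphere 0 1 \<inter> S"
    using y S by (auto simp: subspace_scale)
  moreover have "continuous_on (sphere 0 1 \<inter> S) f"
    unfolding f_def
    by (intro continuous_intros bounded_linear.continuous_on[OF lin])
  ultimately obtain x where x: "x \<in> sphere 0 1 \<inter> S"
    and max: "\<And>z. z \<in> sphere 0 1 \<inter> S \<Longrightarrow> f z \<le> f x"
    using continuous_attains_sup[of "sphere 0 1 \<inter> S" f] by blast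
  define l where "l = f x"
  \<comment> \<open>On \<open>S\<close> this form is nonnegative and it vanishes at
    \<open>x\<close>, so its derivative at \<open>x\<close> along \<open>S\<close> must be
    zero.\<close>
  define g where "g z = l * (z \<bullet> z) - f z" for z
  have g0: "g z \<ge> 0" if "z \<in> S" for z
  proof (cases "z = 0")
    case True
    then show ?thesis by (simp add: g_def f_def)
  next
    case False
    have "f (z /\<^sub>R norm z) \<le> l"
      unfolding l_def using False that S by (intro max) (auto simp: subspace_scale)
    moreover have "f (z /\<^sub>R norm z) = f z / (norm z)\<^sup>2"
      by (simp add: f_def linear_scale[OF bounded_linear.linear[OF lin]] power2_eq_square field_simps)
    ultimately have "f z / (norm z)\<^sup>2 \<le> l" by simp
    then show ?thesis using False
      by (simp add: g_def power2_norm_eq_inner[symmetric] pos_divide_le_eq)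
  qed
  \<comment> \<open>Half the gradient of \<open>g\<close> at \<open>x\<close>. Invariance of
    \<open>S\<close> makes it an admissible direction of variation.\<close>
  define w where "w = l *\<^sub>R x - A *v x"
  have wS: "w \<in> S" using x S inv by (simp add: w_def subspace_diff subspace_scale)
  have gexp: "g (x + r *\<^sub>R w) = 2 * r * (w \<bullet> w) + r\<^sup>2 * g w" for r
  proof -
    have xx: "x \<bullet> x = 1" using x by (simp add: norm_eq_1)
    have A: "A *v (x + r *\<^sub>R w) = A *v x + r *\<^sub>R (A *v w)"
      using linear_add[OF bounded_linear.linear[OF lin]] linear_scale[OF bounded_linear.linear[OF lin]]
      by simp
    have f: "f (x + r *\<^sub>R w) = l + 2 * r * (w \<bullet> (A *v x)) + r\<^sup>2 * f w"
      unfolding f_def A l_def using sym[of x w]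
      by (simp add: inner_add_left inner_add_right inner_commute power2_eq_square algebra_simps)
    have i: "(x + r *\<^sub>R w) \<bullet> (x + r *\<^sub>R w) = 1 + 2 * r * (w \<bullet> x) + r\<^sup>2 * (w \<bullet> w)"
      using xx by (simp add: inner_add_left inner_add_right inner_commute power2_eq_square algebra_simps)
    have w: "w \<bullet> w = l * (w \<bullet> x) - w \<bullet> (A *v x)"
      by (subst (2) w_def) (simp add: inner_diff_right)
    have "g (x + r *\<^sub>R w) = 2 * r * (l * (w \<bullet> x) - w \<bullet> (A *v x)) + r\<^sup>2 * g w"
      unfolding g_def f i by (simp add: algebra_simps)
    then show ?thesis by (simp only: w)
  qed
  have ge: "0 \<le> 2 * r * (w \<bullet> w) + r\<^sup>2 * g w" for r
    using g0[of "x + r *\<^sub>R w"] gexp[of r] x wS S by (simp add: subspace_add subspace_scale)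
  have "w \<bullet> w = 0"
  proof (rule ccontr)
    assume "w \<bullet> w \<noteq> 0"
    then have p: "w \<bullet> w > 0" by simp
    \<comment> \<open>The minimizer of
      \<open>2 * r * (w \<bullet> w) + r\<^sup>2 * (1 + g w)\<close>; the summand 1 keeps the
      denominator positive even when \<open>g w = 0\<close>.\<close>
    define r where "r = - (w \<bullet> w) / (1 + g w)"
    have "g w \<ge> 0" using g0 wS by blast
    then have "2 * r * (w \<bullet> w) + r\<^sup>2 * g w \<le> 2 * r * (w \<bullet> w) + r\<^sup>2 * (1 + g w)"
      by (simp add: algebra_simps)
    also have "r\<^sup>2 * (1 + g w) = r * (r * (1 + g w))"
      by (simp only: power2_eq_square mult.assoc)
    also have "r * (1 + g w) = - (w \<bullet> w)"
      using \<open>g w \<ge> 0\<close> by (simp add: r_def)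
    also have "2 * r * (w \<bullet> w) + r * - (w \<bullet> w) < 0"
      using mult_neg_pos[of r "w \<bullet> w"] \<open>g w \<ge> 0\<close> p
      by (simp add: r_def divide_neg_pos)
    finally show False using ge[of r] by simp
  qed
  then have "A *v x = l *\<^sub>R x" by (simp add: w_def)
  then show ?thesis using x by auto
qed

text \<open>Induction over index sets: the eigenvectors found so far have an invariant orthogonal
  complement, and a unit eigenvector taken from it receives the new index.\<close>

lemma hermitian_orthonormal_eigenvectors:
  fixes A :: "complex ^ 'n ^ 'n"
  assumes A: "hermitian A"
  shows "finite B \<Longrightarrow> \<exists>v::'n \<Rightarrow> complex ^ 'n. \<exists>k::'n \<Rightarrow> real.
    (\<forall>i\<in>B. \<forall>j\<in>B. (\<Sum>l\<in>UNIV. cnj (v i $ l) * v j $ l) = (if i = j then 1 else 0)) \<and>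
    (\<forall>i\<in>B. A *v v i = k i *\<^sub>R v i)"
proof (induction B rule: finite_induct)
  case empty
  then show ?case by simp
next
  case (insert b B)
  then obtain v :: "'n \<Rightarrow> complex ^ 'n" and k :: "'n \<Rightarrow> real"
    where o: "\<And>i j. i \<in> B \<Longrightarrow> j \<in> B \<Longrightarrow> (\<Sum>l\<in>UNIV. cnj (v i $ l) * v j $ l) = (if i = j then 1 else 0)"
    and e: "\<And>i. i \<in> B \<Longrightarrow> A *v v i = k i *\<^sub>R v i" by blast
  define S where "S = {x. \<forall>i\<in>B. (\<Sum>l\<in>UNIV. cnj (v i $ l) * x $ l) = 0}"
  have "subspace S"
    unfolding subspace_def S_def
    by (auto simp: algebra_simps sum.distrib simp flip: scaleR_sum_right)
  moreover have "A *v x \<in> S" if "x \<in> S" for x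
    using that unfolding S_def
    by (auto simp: hermitian_adjoint[OF A] e simp flip: scaleR_sum_right)
  moreover have "\<exists>x\<in>S. x \<noteq> 0"
  proof -
    \<comment> \<open>Row \<open>b\<close> is zero, so \<open>M\<close> is singular, and a kernel
      vector is orthogonal to every \<open>v i\<close> with \<open>i\<close> in
      \<open>B\<close>.\<close>
    define M :: "complex ^ 'n ^ 'n" where "M = (\<chi> i l. if i \<in> B then cnj (v i $ l) else 0)"
    have "det M = 0"
      using insert.hyps by (intro det_zero_row(2)[of b]) (auto simp: row_def M_def vec_eq_iff)
    then obtain x where x: "M *v x = 0" "x \<noteq> 0"
      using matrix_left_invertible_ker[of M] invertible_det_nz[of M] invertible_left_inverse[of M] by blast
    have "x \<in> S"
      unfolding S_def
    proof (intro CollectI ballI)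
      fix i assume "i \<in> B"
      then have "(\<Sum>l\<in>UNIV. cnj (v i $ l) * x $ l) = (M *v x) $ i"
        by (simp add: M_def matrix_vector_mult_def)
      then show "(\<Sum>l\<in>UNIV. cnj (v i $ l) * x $ l) = 0" using x(1) by simp
    qed
    then show ?thesis using x(2) by blast
  qed
  ultimately obtain x l where x: "x \<in> S" "norm x = 1" "A *v x = l *\<^sub>R x"
    using hermitian_eigenvector_in_subspace[OF A] by metis
  have xx: "(\<Sum>l\<in>UNIV. cnj (x $ l) * x $ l) = 1"
  proof -
    have "(\<Sum>l\<in>UNIV. cnj (x $ l) * x $ l) = complex_of_real ((norm x)\<^sup>2)"
      by (simp add: norm_vec_def L2_set_def sum_nonneg complex_norm_square mult.commute del: of_real_power)
    then show ?thesis using x by simp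
  qed
  have xv: "(\<Sum>l\<in>UNIV. cnj (v i $ l) * x $ l) = 0" if "i \<in> B" for i
    using x that by (auto simp: S_def)
  have vx: "(\<Sum>l\<in>UNIV. cnj (x $ l) * v i $ l) = 0" if "i \<in> B" for i
    using arg_cong[OF xv[OF that], of cnj] by (simp add: mult.commute)
  show ?case
    by (rule exI[of _ "v(b := x)"], rule exI[of _ "k(b := l)"])
      (use insert.hyps o e x xx xv vx in auto)
qed

lemma hermitian_diagonalization:
  fixes A :: "complex ^ 'n ^ 'n"
  assumes "hermitian A"
  obtains W :: "complex ^ 'n ^ 'n" and k where "isometry W" "conj_transpose W ** A ** W = diagonal k"
proof -
  obtain v :: "'n \<Rightarrow> complex ^ 'n" and k :: "'n \<Rightarrow> real"
    where o: "\<And>i j. (\<Sum>l\<in>UNIV. cnj (v i $ l) * v j $ l) = (if i = j then 1 else 0)"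
    and e: "\<And>i. A *v v i = k i *\<^sub>R v i"
    using hermitian_orthonormal_eigenvectors[OF assms, of UNIV] by auto
  define W :: "complex ^ 'n ^ 'n" where "W = (\<chi> i j. v j $ i)"
  have W: "isometry W"
    by (simp add: isometry_def W_def gram_nth vec_eq_iff o mat_def)
  have "A ** W = W ** diagonal k"
    using e by (simp add: vec_eq_iff matrix_mult_diagonal_nth) 
      (simp add: W_def matrix_matrix_mult_def matrix_vector_mult_def scaleR_conv_of_real mult.commute)
  then have "conj_transpose W ** A ** W = diagonal k"
    using W by (metis isometry_def matrix_mul_assoc matrix_mul_lid)
  with W show thesis by (rule that)
qed

subsection \<open>The ordered spectrum\<close>

lemma matrix_diff_ldistrib: "A ** (B - C) = A ** B - A ** C"
  for A :: "'a::ring_1 ^ 'm ^ 'n"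
  by (simp add: matrix_matrix_mult_def vec_eq_iff right_diff_distrib sum_subtractf)

lemma matrix_diff_rdistrib: "(A - B) ** C = A ** C - B ** C"
  for C :: "'a::ring_1 ^ 'm ^ 'n"
  by (simp add: matrix_matrix_mult_def vec_eq_iff left_diff_distrib sum_subtractf)

lemma poly_det: "poly (det M) x = det (\<chi> i j. poly (M $ i $ j) x)"
  for M :: "'a::comm_ring_1 poly ^ 'n ^ 'n"
  by (simp add: det_def poly_sum poly_prod)

lemma poly_charpoly: "poly (charpoly A) x = det (mat x - A)"
proof -
  have "(\<chi> i j. poly ((\<chi> i j. (if i = j then [:0, 1:] else 0) - [:A $ i $ j:]) $ i $ j) x) = mat x - A"
    by (simp add: vec_eq_iff mat_def)
  then show ?thesis by (simp add: charpoly_def poly_det)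
qed

text \<open>Complex polynomials are determined by their values, and each value
  \<open>det (mat x - A)\<close> is unchanged under conjugation by \<open>W\<close>.\<close>

lemma charpoly_diagonalization:
  fixes A :: "complex ^ 'n ^ 'n"
  assumes W: "isometry (W :: complex ^ 'n ^ 'n)" and d: "conj_transpose W ** A ** W = diagonal k"
  shows "charpoly A = (\<Prod>i\<in>UNIV. [:- complex_of_real (k i), 1:])"
proof -
  have "poly (charpoly A) x = poly (\<Prod>i\<in>UNIV. [:- complex_of_real (k i), 1:]) x" for x
  proof -
    have "mat x ** W = W ** mat x"
      by (simp add: vec_eq_iff matrix_matrix_mult_def mat_def if_distrib if_distribR mult.commute cong: if_cong)
    then have "conj_transpose W ** mat x ** W = mat x"
      using W by (metis isometry_def matrix_mul_assoc matrix_mul_lid)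
    then have "conj_transpose W ** (mat x - A) ** W = mat x - diagonal k"
      using d by (simp add: matrix_diff_ldistrib matrix_diff_rdistrib)
    then have "det (conj_transpose W) * det (mat x - A) * det W = det (mat x - diagonal k)"
      by (metis det_mul)
    moreover have "det (conj_transpose W) * det W = 1"
      using W by (metis isometry_def det_mul det_I)
    moreover have "det (mat x - diagonal k) = (\<Prod>i\<in>UNIV. x - complex_of_real (k i))"
      by (subst det_diagonal) (auto simp: mat_def diagonal_def)
    ultimately have "det (mat x - A) = (\<Prod>i\<in>UNIV. x - complex_of_real (k i))"
      by (metis mult.commute mult.left_commute mult_1)
    then show ?thesis by (simp add: poly_charpoly poly_prod)
  qed
  then show ?thesis by (simp add: poly_eq_poly_eq_iff[symmetric] fun_eq_iff)
qed

text \<open>Both families list the roots of the characteristic polynomial with multiplicity. This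
  ties the given \<open>lam\<close> to whichever diagonalization is at hand.\<close>

lemma eigenvalue_multiset:
  fixes A :: "complex ^ 'n ^ 'n"
  assumes "ordered_eigenvalues A lam"
    and W: "isometry (W :: complex ^ 'n ^ 'n)" and d: "conj_transpose W ** A ** W = diagonal k"
  shows "image_mset k (mset_set UNIV) = image_mset lam (mset_set {1..CARD('n)})"
proof -
  have p: "proots (\<Prod>i\<in>I. [:- complex_of_real (f i), 1:]) = image_mset (\<lambda>i. complex_of_real (f i)) (mset_set I)"
    if "finite I" for I :: "'b set" and f
    using that by (subst proots_prod) (auto simp: sum_unfold_sum_mset multiset.map_comp o_def image_mset_const_eq)
  have "image_mset (\<lambda>i. complex_of_real (k i)) (mset_set UNIV)
      = image_mset (\<lambda>i. complex_of_real (lam i)) (mset_set {1..CARD('n)})"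
    using assms(1) charpoly_diagonalization[OF W d] unfolding ordered_eigenvalues_def
    by (metis p finite finite_atLeastAtMost)
  then have "image_mset Re (image_mset (\<lambda>i. complex_of_real (k i)) (mset_set UNIV))
      = image_mset Re (image_mset (\<lambda>i. complex_of_real (lam i)) (mset_set {1..CARD('n)}))"
    by simp
  then show ?thesis by (simp add: multiset.map_comp o_def)
qed

text \<open>Equality of the multisets carries counts from \<open>lam\<close> to \<open>k\<close>.
  The strict gap rules out ties across position \<open>r\<close>.\<close>

lemma ordered_eigenvalues_split:
  fixes A :: "complex ^ 'n ^ 'n"
  assumes o: "ordered_eigenvalues A lam"
    and W: "isometry (W :: complex ^ 'n ^ 'n)" and d: "conj_transpose W ** A ** W = diagonal k"
    and r: "0 < r" "r < CARD('n)" and gap: "lam r < lam (r + 1)"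
  defines "J \<equiv> {i. k i \<le> lam r}"
  shows "card J = r" and "i \<notin> J \<Longrightarrow> lam (r + 1) \<le> k i" and "k i \<le> lam CARD('n)"
proof -
  note m = eigenvalue_multiset[OF o W d]
  have mono: "lam x \<le> lam y" if "1 \<le> x" "x \<le> y" "y \<le> CARD('n)" for x y
    using o that unfolding ordered_eigenvalues_def mono_on_def by auto
  have "card J = size (filter_mset (\<lambda>x. x \<le> lam r) (image_mset k (mset_set UNIV)))"
    by (simp add: J_def filter_mset_image_mset)
  also have "\<dots> = card {j \<in> {1..CARD('n)}. lam j \<le> lam r}"
    unfolding m by (simp add: filter_mset_image_mset)
  also have "{j \<in> {1..CARD('n)}. lam j \<le> lam r} = {1..r}"
  proof (intro equalityI subsetI)
    fix j assume j: "j \<in> {j \<in> {1..CARD('n)}. lam j \<le> lam r}"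
    then have "\<not> r + 1 \<le> j" using mono[of "r + 1" j] gap by auto
    then show "j \<in> {1..r}" using j by auto
  qed (use r mono in auto)
  finally show "card J = r" by simp
  have ex: "\<exists>j\<in>{1..CARD('n)}. k i = lam j" for i
  proof -
    have "k i \<in># image_mset k (mset_set UNIV)" by simp
    then show ?thesis unfolding m by auto
  qed
  show "k i \<le> lam CARD('n)"
    using ex[of i] mono by auto
  show "lam (r + 1) \<le> k i" if "i \<notin> J"
  proof -
    obtain j where j: "j \<in> {1..CARD('n)}" "k i = lam j" using ex by blast
    have "\<not> j \<le> r" using that j mono[of j r] r by (auto simp: J_def)
    then show ?thesis using j mono[of "r + 1" j] by simp
  qed
qed

subsection \<open>Unitary invariance\<close>

lemma gram_diagonal_nth:
  "(conj_transpose X ** X) $ j $ j = complex_of_real (\<Sum>i\<in>UNIV. (cmod (X $ i $ j))\<^sup>2)"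
  for X :: "complex ^ 'm ^ 'n"
  by (simp add: gram_nth complex_norm_square mult.commute del: of_real_power)

lemma gram_eq_diagonal_nth:
  fixes X :: "complex ^ 'm ^ 'n"
  assumes "conj_transpose X ** X = diagonal q"
  shows "(\<Sum>i\<in>UNIV. (cmod (X $ i $ j))\<^sup>2) = q j"
proof -
  have "complex_of_real (\<Sum>i\<in>UNIV. (cmod (X $ i $ j))\<^sup>2) = complex_of_real (q j)"
    by (subst gram_diagonal_nth[symmetric]) (simp add: assms, simp add: diagonal_def)
  then show ?thesis by (simp only: of_real_eq_iff)
qed

lemma mat_1_eq_diagonal: "mat 1 = diagonal (\<lambda>_. 1)"
  by (simp add: mat_def diagonal_def vec_eq_iff)

lemma isometry_column_norm:
  "isometry X \<Longrightarrow> (\<Sum>i\<in>UNIV. (cmod (X $ i $ j))\<^sup>2) = 1" for X :: "complex ^ 'm ^ 'n"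
  using gram_eq_diagonal_nth[of X "\<lambda>_. 1" j] by (simp add: isometry_def mat_1_eq_diagonal)

lemma frobenius_norm_sum:
  "(norm X)\<^sup>2 = (\<Sum>j\<in>UNIV. \<Sum>i\<in>UNIV. (cmod (X $ i $ j))\<^sup>2)" for X :: "complex ^ 'm ^ 'n"
  by (simp add: norm_vec_def L2_set_def sum_nonneg) (rule sum.swap)

lemma frobenius_norm_trace: "(norm X)\<^sup>2 = Re (trace (conj_transpose X ** X))"
  for X :: "complex ^ 'm ^ 'n"
  by (simp add: frobenius_norm_sum trace_def gram_diagonal_nth)

lemma trace_unitary_conj:
  "isometry W \<Longrightarrow> trace (conj_transpose W ** M ** W) = trace M" for W :: "complex ^ 'n ^ 'n"
  by (metis isometry_right_inverse matrix_mul_assoc matrix_mul_lid trace_mul_sym)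

lemma gram_isometry_mult:
  fixes V :: "complex ^ 'n ^ 'l" and X :: "complex ^ 'm ^ 'n" and W :: "complex ^ 'k ^ 'm"
  assumes "isometry V"
  shows "conj_transpose (V ** X ** W) ** (V ** X ** W) = conj_transpose W ** (conj_transpose X ** X) ** W"
proof -
  have "conj_transpose (V ** X ** W) ** (V ** X ** W)
      = conj_transpose W ** (conj_transpose X ** (conj_transpose V ** V) ** X) ** W"
    by (simp only: conj_transpose_mult matrix_mul_assoc)
  then show ?thesis using assms by (simp add: isometry_def)
qed

lemma norm_unitary_mult:
  fixes V :: "complex ^ 'n ^ 'n" and X :: "complex ^ 'm ^ 'n" and W :: "complex ^ 'm ^ 'm"
  assumes "isometry V" "isometry W"
  shows "norm (V ** X ** W) = norm X"
proof -
  have "(norm (V ** X ** W))\<^sup>2 = (norm X)\<^sup>2"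
    by (simp only: frobenius_norm_trace gram_isometry_mult[OF assms(1)] trace_unitary_conj[OF assms(2)])
  then show ?thesis by simp
qed

text \<open>\<open>V\<close> is absorbed into \<open>H\<close>, and the conjugation by
  \<open>W\<close> disappears under the trace. Hence \<open>H\<close> and the Gram matrix of
  \<open>X\<close> can be diagonalized independently.\<close>

lemma energy0_unitary_mult:
  fixes V :: "complex ^ 'n ^ 'n" and X :: "complex ^ 'm ^ 'n" and W :: "complex ^ 'm ^ 'm"
  assumes V: "isometry V" and W: "isometry W"
  shows "energy0 H (V ** X ** W) = energy0 (conj_transpose V ** H ** V) X"
proof -
  define G where "G = conj_transpose X ** X"
  define B where "B = conj_transpose X ** (conj_transpose V ** H ** V) ** X"
  have "conj_transpose W ** mat 2 ** W = conj_transpose W ** W ** mat 2"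
    by (simp add: vec_eq_iff matrix_matrix_mult_def mat_def if_distrib if_distribR sum_distrib_left mult_ac cong: if_cong)
  then have "mat 2 - conj_transpose W ** G ** W = conj_transpose W ** (mat 2 - G) ** W"
    using W by (simp add: isometry_def matrix_diff_ldistrib matrix_diff_rdistrib)
  moreover have "conj_transpose (V ** X ** W) ** H ** (V ** X ** W) = conj_transpose W ** B ** W"
    by (simp only: B_def conj_transpose_mult matrix_mul_assoc)
  moreover have "(conj_transpose W ** (mat 2 - G) ** W) ** (conj_transpose W ** B ** W)
      = conj_transpose W ** ((mat 2 - G) ** (W ** conj_transpose W) ** B) ** W"
    by (simp only: matrix_mul_assoc)
  ultimately have "trace ((mat 2 - conj_transpose W ** G ** W) ** (conj_transpose (V ** X ** W) ** H ** (V ** X ** W)))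
      = trace ((mat 2 - G) ** B)"
    using W by (simp add: isometry_right_inverse trace_unitary_conj)
  then show ?thesis
    by (simp only: energy0_def gram_isometry_mult[OF V] G_def B_def)
qed

text \<open>Next to a diagonal factor the trace sees only the diagonal of the other factor, so the
  energy decouples into columns.\<close>

lemma energy0_diagonal:
  fixes X :: "complex ^ 'm ^ 'n"
  assumes "conj_transpose X ** X = diagonal q"
  shows "energy0 (diagonal k) X = (\<Sum>j\<in>UNIV. (2 - q j) * (\<Sum>i\<in>UNIV. k i * (cmod (X $ i $ j))\<^sup>2))"
proof -
  have "mat 2 - diagonal q = diagonal (\<lambda>j. 2 - q j)"
    by (simp add: mat_def diagonal_def vec_eq_iff)
  moreover have "(conj_transpose X ** diagonal k ** X) $ j $ j
      = complex_of_real (\<Sum>i\<in>UNIV. k i * (cmod (X $ i $ j))\<^sup>2)" for j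
    by (simp only: matrix_mul_assoc[symmetric] gram_nth diagonal_mult_matrix_nth)
       (simp add: complex_norm_square mult_ac del: of_real_power)
  ultimately show ?thesis
    unfolding energy0_def assms by (simp add: trace_def diagonal_mult_matrix_nth)
qed

subsection \<open>Energy excess and quadratic growth\<close>

lemma bessel_rows:
  fixes u :: "complex ^ 'm ^ 'n"
  assumes g: "conj_transpose u ** u = diagonal e" and e: "\<And>j. e j \<in> {0, 1}"
  shows "(\<Sum>j\<in>UNIV. (cmod (u $ i $ j))\<^sup>2) \<le> 1"
proof -
  define P where "P = u ** conj_transpose u"
  have "u ** diagonal e = u"
  proof -
    have "u $ i $ j * e j = u $ i $ j" for i j
    proof (cases "e j = 0")
      case True
      then have "(\<Sum>i\<in>UNIV. (cmod (u $ i $ j))\<^sup>2) = 0" using gram_eq_diagonal_nth[OF g] by simp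
      then have "u $ i $ j = 0" by (simp add: sum_nonneg_eq_0_iff)
      then show ?thesis by simp
    qed (use e[of j] in auto)
    then show ?thesis by (simp add: vec_eq_iff matrix_mult_diagonal_nth)
  qed
  then have "P ** P = P"
    unfolding P_def using g by (metis matrix_mul_assoc)
  moreover have h: "conj_transpose P = P" by (simp add: P_def conj_transpose_mult)
  ultimately have "(conj_transpose P ** P) $ i $ i = P $ i $ i" by simp
  moreover have Pii: "P $ i $ i = complex_of_real (\<Sum>j\<in>UNIV. (cmod (u $ i $ j))\<^sup>2)" (is "_ = complex_of_real ?r")
    by (simp add: P_def matrix_matrix_mult_def conj_transpose_def complex_norm_square del: of_real_power)
  ultimately have "(\<Sum>l\<in>UNIV. (cmod (P $ l $ i))\<^sup>2) = ?r"
    by (simp only: gram_diagonal_nth of_real_eq_iff)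
  moreover have "(cmod (P $ i $ i))\<^sup>2 \<le> (\<Sum>l\<in>UNIV. (cmod (P $ l $ i))\<^sup>2)"
    by (rule member_le_sum) auto
  moreover have "cmod (P $ i $ i) = ?r"
    unfolding Pii norm_of_real by (simp add: sum_nonneg)
  ultimately have "?r * ?r \<le> ?r * 1" "0 \<le> ?r"
    by (simp_all add: power2_eq_square sum_nonneg)
  then show ?thesis by (metis mult_le_cancel_left order_le_less zero_le_one)
qed

text \<open>A quantitative Ky Fan principle: the rows carry weights in \<open>[0, 1]\<close> of
  total at most \<open>CARD('m)\<close>. The deficit \<open>t\<close> on \<open>J\<close> bounds the
  weight outside \<open>J\<close>, and each unit of weight moved out of \<open>J\<close> costs at
  least \<open>A - B\<close>.\<close>

lemma ky_fan_gap:
  fixes u :: "complex ^ 'm ^ 'n" and a :: "'n \<Rightarrow> real"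
  assumes g: "conj_transpose u ** u = diagonal e" and e: "\<And>j. e j \<in> {0, 1}"
    and J: "card J = CARD('m)"
    and lo: "\<And>i. i \<in> J \<Longrightarrow> A \<le> a i" and hi: "\<And>i. i \<notin> J \<Longrightarrow> a i \<le> B" and B: "0 \<le> B"
  defines "t \<equiv> real CARD('m) - (\<Sum>i\<in>J. \<Sum>j\<in>UNIV. (cmod (u $ i $ j))\<^sup>2)"
  shows "0 \<le> t" and "(A - B) * t \<le> sum a J - (\<Sum>j\<in>UNIV. \<Sum>i\<in>UNIV. a i * (cmod (u $ i $ j))\<^sup>2)"
proof -
  define r where "r i = (\<Sum>j\<in>UNIV. (cmod (u $ i $ j))\<^sup>2)" for i
  have r: "0 \<le> r i" "r i \<le> 1" for i
    using bessel_rows[OF g e] by (simp_all add: r_def sum_nonneg)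
  have t: "t = (\<Sum>i\<in>J. 1 - r i)"
    by (simp add: t_def r_def sum_subtractf J)
  then show "0 \<le> t" using r by (simp add: sum_nonneg)
  have "sum r UNIV = (\<Sum>j\<in>UNIV. e j)"
    unfolding r_def by (subst sum.swap) (simp add: gram_eq_diagonal_nth[OF g])
  also have "\<dots> \<le> (\<Sum>j\<in>(UNIV::'m set). 1)"
    using e by (intro sum_mono) (metis insertE singletonD order_refl zero_le_one)
  finally have "sum r UNIV \<le> real CARD('m)" by simp
  moreover have split: "sum f UNIV = sum f J + sum f (- J)" for f :: "'n \<Rightarrow> real"
    by (metis Compl_eq_Diff_UNIV finite sum.subset_diff subset_UNIV add.commute)
  ultimately have rc: "sum r (- J) \<le> t"
    by (simp add: t_def r_def)
  have "(A - B) * t \<le> A * t - B * sum r (- J)"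
    using rc B mult_left_mono[OF rc B] by (simp add: algebra_simps)
  also have "\<dots> = (\<Sum>i\<in>J. A * (1 - r i)) - (\<Sum>i\<in>-J. B * r i)"
    by (simp add: t sum_distrib_left)
  also have "\<dots> \<le> (\<Sum>i\<in>J. a i * (1 - r i)) - (\<Sum>i\<in>-J. a i * r i)"
    using lo hi r by (intro diff_mono sum_mono mult_right_mono) auto
  also have "\<dots> = sum a J - (\<Sum>i\<in>UNIV. a i * r i)"
    by (simp add: split algebra_simps sum_subtractf)
  also have "(\<Sum>i\<in>UNIV. a i * r i) = (\<Sum>j\<in>UNIV. \<Sum>i\<in>UNIV. a i * (cmod (u $ i $ j))\<^sup>2)"
    unfolding r_def sum_distrib_left by (rule sum.swap)
  finally show "(A - B) * t \<le> sum a J - (\<Sum>j\<in>UNIV. \<Sum>i\<in>UNIV. a i * (cmod (u $ i $ j))\<^sup>2)" .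
qed

section \<open>Coordinate subspaces and the polar factor\<close>

text \<open>Serves twice: its conjugate transpose selects the rows \<open>g k\<close>, and its
  products with unitary matrices supply the minimizers for a diagonal \<open>H\<close> when
  \<open>g\<close> enumerates the lowest entries.\<close>

definition coordinate_embedding :: "('m \<Rightarrow> 'n) \<Rightarrow> complex ^ 'm ^ 'n" where
  "coordinate_embedding g = (\<chi> i k. if i = g k then 1 else 0)"

lemma conj_transpose_coordinate_embedding_mult_nth:
  "(conj_transpose (coordinate_embedding g) ** X) $ k $ j = X $ g k $ j"
  for X :: "complex ^ 'l ^ 'n"
proof -
  have "cnj (coordinate_embedding g $ i $ k) * X $ i $ j = (if g k = i then X $ i $ j else 0)" for i
    by (simp add: coordinate_embedding_def)
  then show ?thesis by (simp add: gram_nth)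
qed

lemma isometry_coordinate_embedding:
  assumes "inj g"
  shows "isometry (coordinate_embedding g)"
  using assms
  by (simp add: isometry_def vec_eq_iff conj_transpose_coordinate_embedding_mult_nth mat_def inj_eq)
     (simp add: coordinate_embedding_def inj_eq)

lemma energy0_coordinate_embedding:
  fixes g :: "'m::finite \<Rightarrow> 'n::finite" and Z :: "complex ^ 'm ^ 'm"
  assumes g: "inj g" and Z: "isometry Z"
  shows "energy0 (diagonal k) (coordinate_embedding g ** Z) = (\<Sum>j\<in>UNIV. k (g j))"
proof -
  \<comment> \<open>The factor \<open>mat 1\<close> gives the product the two-sided shape of
    \<open>energy0_unitary_mult\<close>, which then removes \<open>Z\<close>.\<close>
  have "energy0 (diagonal k) (mat 1 ** coordinate_embedding g ** Z)
      = energy0 (diagonal k) (coordinate_embedding g :: complex ^ 'm ^ 'n)"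
    using Z by (subst energy0_unitary_mult) (auto simp: isometry_def)
  also have "\<dots> = (\<Sum>j\<in>UNIV. (2 - 1) * (\<Sum>i\<in>UNIV. k i * (cmod (coordinate_embedding g $ i $ j))\<^sup>2))"
    by (rule energy0_diagonal)
       (use isometry_coordinate_embedding[OF g] in \<open>simp add: isometry_def mat_1_eq_diagonal\<close>)
  also have "\<dots> = (\<Sum>j\<in>UNIV. k (g j))"
  proof -
    have "k i * (cmod (coordinate_embedding g $ i $ j))\<^sup>2 = (if i = g j then k i else 0)" for i j
      by (simp add: coordinate_embedding_def)
    then show ?thesis by simp
  qed
  finally show ?thesis by simp
qed

text \<open>The witness is the unitary factor in the polar decomposition of the selected rows of \<open>u\<close>.\<close>
lemma nearby_unitary:
  fixes u :: "complex ^ 'm ^ 'n" and g :: "'m::finite \<Rightarrow> 'n::finite"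
  assumes u: "isometry u" and g: "inj g"
  defines "t \<equiv> real CARD('m) - (\<Sum>k\<in>UNIV. \<Sum>j\<in>UNIV. (cmod (u $ g k $ j))\<^sup>2)"
  assumes t: "t < 1"
  obtains Z p where "isometry (Z :: complex ^ 'm ^ 'm)"
    "\<And>j. (conj_transpose u ** (coordinate_embedding g ** Z)) $ j $ j = complex_of_real (p j)"
    "\<And>j. p j \<le> 1" "(2 - t) * (\<Sum>j\<in>UNIV. 1 - p j) \<le> t"
proof -
  define E where "E = (coordinate_embedding g :: complex ^ 'm ^ 'n)"
  define R where "R = conj_transpose E ** u"
  \<comment> \<open>The columns of \<open>L\<close> are right singular vectors of \<open>R\<close>,
    and \<open>d\<close> holds the squared singular values.\<close>
  obtain L :: "complex ^ 'm ^ 'm" and d where L: "isometry L"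
    and d: "conj_transpose L ** (conj_transpose R ** R) ** L = diagonal d"
    using hermitian_diagonalization[OF hermitian_gram] by metis
  have RL: "conj_transpose (R ** L) ** (R ** L) = diagonal d"
    using d by (simp add: conj_transpose_mult matrix_mul_assoc)
  have RL': "(R ** L) $ k $ j = (u ** L) $ g k $ j" for k j
    unfolding R_def E_def by (simp add: matrix_mul_assoc[symmetric] conj_transpose_coordinate_embedding_mult_nth)
  have d_le: "d j \<le> 1" for j
  proof -
    have "d j = (\<Sum>k\<in>UNIV. (cmod ((u ** L) $ g k $ j))\<^sup>2)"
      using gram_eq_diagonal_nth[OF RL, of j] by (simp add: RL')
    also have "\<dots> = (\<Sum>i\<in>range g. (cmod ((u ** L) $ i $ j))\<^sup>2)"
      by (simp add: sum.reindex[OF g] o_def)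
    also have "\<dots> \<le> (\<Sum>i\<in>UNIV. (cmod ((u ** L) $ i $ j))\<^sup>2)"
      by (rule sum_mono2) auto
    also have "\<dots> = 1" by (rule isometry_column_norm[OF isometry_mult[OF u L]])
    finally show ?thesis .
  qed
  have "complex_of_real (\<Sum>j\<in>UNIV. d j) = trace (conj_transpose L ** (conj_transpose R ** R) ** L)"
    unfolding d by (simp add: trace_def diagonal_def)
  also have "\<dots> = complex_of_real (\<Sum>j\<in>UNIV. \<Sum>k\<in>UNIV. (cmod (R $ k $ j))\<^sup>2)"
    unfolding trace_unitary_conj[OF L] by (simp only: trace_def gram_diagonal_nth of_real_sum)
  also have "(\<Sum>j\<in>UNIV. \<Sum>k\<in>UNIV. (cmod (R $ k $ j))\<^sup>2) = real CARD('m) - t"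
    unfolding R_def E_def conj_transpose_coordinate_embedding_mult_nth t_def
    by (subst sum.swap) simp
  finally have sd: "(\<Sum>j\<in>UNIV. 1 - d j) = t"
    by (simp only: of_real_eq_iff sum_subtractf) simp
  \<comment> \<open>The deficits \<open>1 - d j\<close> are nonnegative with sum \<open>t\<close>,
    so each is at most \<open>t\<close>; since \<open>t < 1\<close>, all singular values are
    positive.\<close>
  have d_ge: "1 - t \<le> d j" for j
    using member_le_sum[of j UNIV "\<lambda>j. 1 - d j"] d_le sd by simp
  define c where "c j = sqrt (d j)" for j
  have dp: "d j > 0" for j using d_ge[of j] t by linarith
  have c: "c j > 0" "c j * c j = d j" "c j \<le> 1" for j
    using dp[of j] d_le[of j] by (simp_all add: c_def)
  \<comment> \<open>Normalizing the columns of \<open>R ** L\<close> gives left singular vectors, so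
    \<open>K ** conj_transpose L\<close> is the unitary polar factor of \<open>R\<close>.\<close>
  define K where "K = R ** L ** diagonal (\<lambda>j. inverse (c j))"
  have RK: "conj_transpose (R ** L) ** K = diagonal c"
  proof -
    have "conj_transpose (R ** L) ** K
        = conj_transpose (R ** L) ** (R ** L) ** diagonal (\<lambda>j. inverse (c j))"
      by (simp only: K_def matrix_mul_assoc)
    also have "\<dots> = diagonal c"
      unfolding RL diagonal_mult_diagonal c(2)[symmetric]
      using c(1) by (simp add: less_imp_neq[symmetric] mult.assoc)
    finally show ?thesis .
  qed
  have K: "isometry K"
  proof -
    have "conj_transpose K ** K = diagonal (\<lambda>j. inverse (c j)) ** (conj_transpose (R ** L) ** K)"
      by (subst (1) K_def) (simp add: conj_transpose_mult matrix_mul_assoc)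
    then show ?thesis
      unfolding RK diagonal_mult_diagonal isometry_def mat_1_eq_diagonal
      using c(1) by (simp add: less_imp_neq[symmetric])
  qed
  define Z where "Z = K ** conj_transpose L"
  define p where "p j = (\<Sum>k\<in>UNIV. c k * (cmod (L $ j $ k))\<^sup>2)" for j
  have rowL: "(\<Sum>k\<in>UNIV. (cmod (L $ j $ k))\<^sup>2) = 1" for j
    using isometry_column_norm[OF isometry_conj_transpose[OF L], of j]
    by (simp add: conj_transpose_def)
  have uZ: "(conj_transpose u ** (E ** Z)) $ j $ j = complex_of_real (p j)" for j
  proof -
    \<comment> \<open>The product turns out to be the positive square root of
      \<open>conj_transpose R ** R\<close>, whose diagonal is real.\<close>
    have "conj_transpose u ** (E ** Z) = L ** conj_transpose L ** conj_transpose R ** Z"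
      by (simp add: isometry_right_inverse[OF L] R_def conj_transpose_mult matrix_mul_assoc)
    also have "\<dots> = L ** (conj_transpose (R ** L) ** K) ** conj_transpose L"
      by (simp only: Z_def conj_transpose_mult matrix_mul_assoc)
    also have "\<dots> = L ** diagonal c ** conj_transpose L"
      by (simp only: RK)
    finally have "(conj_transpose u ** (E ** Z)) $ j $ j
        = (\<Sum>k\<in>UNIV. (L ** diagonal c) $ j $ k * cnj (L $ j $ k))"
      by (simp add: matrix_matrix_mult_def conj_transpose_def)
    then show ?thesis
      by (simp add: matrix_mult_diagonal_nth p_def complex_norm_square mult_ac del: of_real_power)
  qed
  \<comment> \<open>\<open>p j\<close> is an average of the singular values, because row
    \<open>j\<close> of the unitary \<open>L\<close> has norm 1.\<close>
  have p: "1 - p j = (\<Sum>k\<in>UNIV. (1 - c k) * (cmod (L $ j $ k))\<^sup>2)" for j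
    unfolding p_def by (simp add: left_diff_distrib sum_subtractf rowL)
  have "p j \<le> 1" for j
    using p[of j] c(3) by (smt (verit) sum_nonneg mult_nonneg_nonneg zero_le_power2)
  moreover have "(\<Sum>j\<in>UNIV. 1 - p j) = (\<Sum>k\<in>UNIV. 1 - c k)"
    unfolding p by (subst sum.swap) (simp add: sum_distrib_left[symmetric] isometry_column_norm[OF L])
  moreover have "(2 - t) * (\<Sum>k\<in>UNIV. 1 - c k) \<le> t"
  proof -
    \<comment> \<open>From \<open>1 - d k = (1 + c k) * (1 - c k)\<close> and
      \<open>1 + c k \<ge> 1 + d k \<ge> 2 - t\<close>. A factor close to 2 is what later permits
      every \<alpha> below 1.\<close>
    have "(2 - t) * (1 - c k) \<le> 1 - d k" for k
    proof -
      have "d k \<le> c k" using c[of k] mult_left_mono[of "c k" 1 "c k"] by simp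
      then have "2 - t \<le> 1 + c k" using d_ge[of k] by linarith
      then have "(2 - t) * (1 - c k) \<le> (1 + c k) * (1 - c k)"
        using c(3)[of k] by (intro mult_right_mono) auto
      also have "\<dots> = 1 - d k" using c(2)[of k] by (simp add: algebra_simps)
      finally show ?thesis .
    qed
    then have "(\<Sum>k\<in>UNIV. (2 - t) * (1 - c k)) \<le> (\<Sum>k\<in>UNIV. 1 - d k)"
      by (rule sum_mono)
    then show ?thesis by (simp only: sum_distrib_left sd)
  qed
  ultimately show thesis
    using that[OF isometry_mult[OF K isometry_conj_transpose[OF L], folded Z_def] uZ[unfolded E_def]]
    by simp
qed

text \<open>In each column \<open>s\<^sup>2 + 1 - 2 * s * p = (1 - s)\<^sup>2 + 2 * s * (1 -
  p)\<close>: an error in length plus an error in direction.\<close>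

lemma norm_scaled_isometry_diff:
  fixes u Y :: "complex ^ 'm ^ 'n"
  assumes u: "isometry u" and Y: "isometry Y"
    and p: "\<And>j. (conj_transpose u ** Y) $ j $ j = complex_of_real (p j)"
  shows "(norm (u ** diagonal s - Y))\<^sup>2 = (\<Sum>j\<in>UNIV. (1 - s j)\<^sup>2 + 2 * s j * (1 - p j))"
proof -
  have "(\<Sum>i\<in>UNIV. (cmod ((u ** diagonal s - Y) $ i $ j))\<^sup>2) = (1 - s j)\<^sup>2 + 2 * s j * (1 - p j)" for j
  proof -
    have e: "(cmod ((u ** diagonal s - Y) $ i $ j))\<^sup>2 = (s j)\<^sup>2 * (cmod (u $ i $ j))\<^sup>2
        + (cmod (Y $ i $ j))\<^sup>2 - 2 * s j * Re (cnj (u $ i $ j) * Y $ i $ j)" for i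
      by (simp add: matrix_mult_diagonal_nth cmod_power2) (simp add: power2_eq_square algebra_simps)
    have "(\<Sum>i\<in>UNIV. Re (cnj (u $ i $ j) * Y $ i $ j)) = p j"
      using p[of j] by (simp only: gram_nth flip: Re_sum) simp
    then show ?thesis
      unfolding e
      by (simp only: sum.distrib sum_subtractf sum_distrib_left[symmetric]
          isometry_column_norm[OF u] isometry_column_norm[OF Y]) (simp add: power2_eq_square algebra_simps)
  qed
  then show ?thesis by (simp add: frobenius_norm_sum)
qed


section \<open>Completing the square and quadratic growth\<close>

text \<open>Since \<open>inverse 0 = 0\<close>, a zero column of \<open>X\<close> stays zero in
  \<open>u\<close>, which accounts for the zeros in the Gram matrix of \<open>u\<close>.\<close>

lemma normalized_columns:
  fixes X :: "complex ^ 'm ^ 'n"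
  assumes X: "conj_transpose X ** X = diagonal q"
  defines "u \<equiv> X ** diagonal (\<lambda>j. inverse (sqrt (q j)))"
  shows "0 \<le> q j" "X = u ** diagonal (\<lambda>j. sqrt (q j))"
    "conj_transpose u ** u = diagonal (\<lambda>j. if q j = 0 then 0 else 1)"
proof -
  have q: "0 \<le> q j" for j
    using gram_eq_diagonal_nth[OF X, of j] by (metis sum_nonneg zero_le_power2)
  show "0 \<le> q j" by (rule q)
  have X0: "X $ i $ j = 0" if "q j = 0" for i j
    using gram_eq_diagonal_nth[OF X, of j] that by (simp add: sum_nonneg_eq_0_iff)
  have "X $ i $ j * complex_of_real (inverse (sqrt (q j))) * complex_of_real (sqrt (q j)) = X $ i $ j" for i j
    by (cases "q j = 0") (simp_all add: X0)
  then show "X = u ** diagonal (\<lambda>j. sqrt (q j))"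
    by (simp only: vec_eq_iff u_def matrix_mult_diagonal_nth) simp
  have "conj_transpose u ** u = diagonal (\<lambda>j. inverse (sqrt (q j))) ** (conj_transpose X ** X)
      ** diagonal (\<lambda>j. inverse (sqrt (q j)))"
    by (simp add: u_def conj_transpose_mult matrix_mul_assoc)
  also have "\<dots> = diagonal (\<lambda>j. if q j = 0 then 0 else 1)"
    unfolding X diagonal_mult_diagonal
    by (rule arg_cong[of _ _ diagonal]) (use q in \<open>auto simp: fun_eq_iff field_simps\<close>)
  finally show "conj_transpose u ** u = diagonal (\<lambda>j. if q j = 0 then 0 else 1)" .
qed

text \<open>The identity \<open>- (2 - q) * q = (1 - q)\<^sup>2 - 1\<close> in each column splits
  the excess into a length part and a direction part; \<open>ky_fan_gap\<close> with
  \<open>a = - k\<close> bounds the latter.\<close>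

lemma energy_excess:
  fixes X :: "complex ^ 'm ^ 'n" and g :: "'m::finite \<Rightarrow> 'n::finite" and k :: "'n \<Rightarrow> real"
  assumes X: "conj_transpose X ** X = diagonal q" and g: "inj g"
    and lo: "\<And>j. k (g j) \<le> - A" and hi: "\<And>i. i \<notin> range g \<Longrightarrow> - B \<le> k i" and B: "0 \<le> B"
  defines "u \<equiv> X ** diagonal (\<lambda>j. inverse (sqrt (q j)))"
  defines "t \<equiv> real CARD('m) - (\<Sum>l\<in>UNIV. \<Sum>j\<in>UNIV. (cmod (u $ g l $ j))\<^sup>2)"
  shows "0 \<le> t"
    and "(A - B) * t + (\<Sum>j\<in>UNIV. (1 - q j)\<^sup>2 * (\<Sum>i\<in>UNIV. - k i * (cmod (u $ i $ j))\<^sup>2))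
      \<le> energy0 (diagonal k) X - (\<Sum>j\<in>UNIV. k (g j))"
proof -
  note n = normalized_columns[OF X, folded u_def]
  have J: "card (range g) = CARD('m)" using g by (rule card_image)
  have sum_range: "sum f (range g) = (\<Sum>j\<in>UNIV. f (g j))" for f :: "'n \<Rightarrow> real"
    by (simp add: sum.reindex[OF g] o_def)
  note kf = ky_fan_gap[OF n(3) _ J, of A "\<lambda>i. - k i" B, unfolded sum_range, folded t_def]
  show "0 \<le> t" by (rule kf(1)) (use lo hi B in \<open>auto simp: minus_le_iff le_minus_iff\<close>)
  have kf2: "(A - B) * t \<le> (\<Sum>j\<in>UNIV. - k (g j)) - (\<Sum>j\<in>UNIV. \<Sum>i\<in>UNIV. - k i * (cmod (u $ i $ j))\<^sup>2)"
    by (rule kf(2)) (use lo hi B in \<open>auto simp: minus_le_iff le_minus_iff\<close>)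
  have Xu: "(cmod (X $ i $ j))\<^sup>2 = q j * (cmod (u $ i $ j))\<^sup>2" for i j
    using n(1)[of j] by (subst n(2)) (simp add: matrix_mult_diagonal_nth norm_mult power_mult_distrib)
  have "energy0 (diagonal k) X = (\<Sum>j\<in>UNIV. ((1 - q j)\<^sup>2 - 1) * (\<Sum>i\<in>UNIV. - k i * (cmod (u $ i $ j))\<^sup>2))"
    unfolding energy0_diagonal[OF X] Xu
    by (simp add: sum_distrib_left power2_eq_square algebra_simps)
  then show "(A - B) * t + (\<Sum>j\<in>UNIV. (1 - q j)\<^sup>2 * (\<Sum>i\<in>UNIV. - k i * (cmod (u $ i $ j))\<^sup>2))
      \<le> energy0 (diagonal k) X - (\<Sum>j\<in>UNIV. k (g j))"
    using kf2 by (simp add: left_diff_distrib sum_subtractf sum_negf)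
qed

lemma quadratic_growth_diagonal:
  fixes X :: "complex ^ 'm ^ 'n" and g :: "'m::finite \<Rightarrow> 'n::finite" and k :: "'n \<Rightarrow> real"
  assumes X: "conj_transpose X ** X = diagonal q" and g: "inj g"
    and lo: "\<And>j. k (g j) \<le> - A" and hi: "\<And>i. i \<notin> range g \<Longrightarrow> - B \<le> k i"
    and B: "0 \<le> B" and AB: "B < A" and k: "\<And>i. k i \<le> 0"
    and \<alpha>: "0 < \<alpha>" "\<alpha> < 1"
  defines "\<delta> \<equiv> energy0 (diagonal k) X - (\<Sum>j\<in>UNIV. k (g j))"
  assumes small: "\<delta> \<le> (A - B) * (((1 - \<alpha>) / 2)\<^sup>2 / 2)"
  shows "\<exists>Z. isometry Z \<and> \<alpha> * (A - B) * (norm (X - coordinate_embedding g ** Z))\<^sup>2 \<le> \<delta>"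
proof -
  define u where "u = X ** diagonal (\<lambda>j. inverse (sqrt (q j)))"
  define s where "s j = sqrt (q j)" for j
  define t where "t = real CARD('m) - (\<Sum>l\<in>UNIV. \<Sum>j\<in>UNIV. (cmod (u $ g l $ j))\<^sup>2)"
  define a where "a j = (\<Sum>i\<in>UNIV. - k i * (cmod (u $ i $ j))\<^sup>2)" for j
  \<comment> \<open>\<open>\<eta>\<close> will bound \<open>s j - 1\<close> and
    \<open>\<epsilon>\<close> will bound \<open>t\<close>. The choice ensures
    \<open>\<alpha> \<le> 1 - \<epsilon>\<close> and, for \<open>t \<le> \<epsilon>\<close>, also
    \<open>2 * (\<alpha> * (1 + \<eta>)) \<le> 2 - t\<close>.\<close>
  define \<eta> where "\<eta> = (1 - \<alpha>) / 2"
  define \<epsilon> where "\<epsilon> = \<eta>\<^sup>2 / 2"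
  have \<eta>: "0 < \<eta>" "\<eta> < 1 / 2" using \<alpha> by (simp_all add: \<eta>_def)
  have \<epsilon>: "0 < \<epsilon>" "\<epsilon> \<le> \<eta>" "\<epsilon> < 1 / 2"
    using \<eta> mult_strict_mono[of \<eta> "1/2" \<eta> "1/2"] by (auto simp: \<epsilon>_def power2_eq_square)
  note n = normalized_columns[OF X, folded u_def]
  note ex = energy_excess[where k = k and g = g and A = A and B = B, OF X g lo hi B, folded u_def, folded t_def, folded a_def \<delta>_def]
  have t0: "0 \<le> t" using ex(1) .
  have a0: "0 \<le> a j" for j
    unfolding a_def using k by (intro sum_nonneg mult_nonneg_nonneg) auto
  have excess: "(A - B) * t + (\<Sum>j\<in>UNIV. (1 - q j)\<^sup>2 * a j) \<le> \<delta>" using ex(2) .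
  have "0 \<le> (\<Sum>j\<in>UNIV. (1 - q j)\<^sup>2 * a j)" using a0 by (intro sum_nonneg) auto
  then have "(A - B) * t \<le> (A - B) * \<epsilon>" using excess small by (simp add: \<epsilon>_def \<eta>_def)
  then have t: "t \<le> \<epsilon>" using AB by simp
  define c where "c j = (\<Sum>l\<in>UNIV. (cmod (u $ g l $ j))\<^sup>2)" for j
  have c_sum: "c j = (\<Sum>i\<in>range g. (cmod (u $ i $ j))\<^sup>2)" for j
    by (simp add: c_def sum.reindex[OF g] o_def)
  have c_le: "c j \<le> (if q j = 0 then 0 else 1)" for j
    unfolding c_sum gram_eq_diagonal_nth[OF n(3), symmetric] by (rule sum_mono2) auto
  have c1: "c j \<le> 1" for j using c_le[of j] by (simp split: if_splits)
  have "t = (\<Sum>j\<in>UNIV. 1 - c j)"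
    unfolding t_def c_def by (subst sum.swap) (simp add: sum_subtractf)
  then have c_ge: "1 - t \<le> c j" for j
    using member_le_sum[of j UNIV "\<lambda>j. 1 - c j"] c1 by simp
  \<comment> \<open>A zero column would have \<open>c j = 0\<close>, but
    \<open>c j \<ge> 1 - t > 0\<close>. Hence \<open>u\<close> is a genuine isometry.\<close>
  have "q j \<noteq> 0" for j
    using c_le[of j] c_ge[of j] t \<epsilon> by auto
  then have u: "isometry u"
    using n(3) by (simp add: isometry_def mat_1_eq_diagonal)
  \<comment> \<open>The rows in the range of \<open>g\<close> alone contribute at least
    \<open>A * c j\<close>; the other rows contribute nonnegative terms.\<close>
  have a_ge: "(A - B) * (1 - \<epsilon>) \<le> a j" for j
  proof -
    have "(A - B) * (1 - \<epsilon>) \<le> A * c j"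
      using c_ge[of j] t \<epsilon> AB B by (intro mult_mono) auto
    also have "\<dots> = (\<Sum>i\<in>range g. A * (cmod (u $ i $ j))\<^sup>2)"
      by (simp add: c_sum sum_distrib_left)
    also have "\<dots> \<le> (\<Sum>i\<in>range g. - k i * (cmod (u $ i $ j))\<^sup>2)"
      using lo by (intro sum_mono mult_right_mono) (auto simp: le_minus_iff)
    also have "\<dots> \<le> a j"
      unfolding a_def using k by (intro sum_mono2) (auto intro: mult_nonpos_nonneg)
    finally show ?thesis .
  qed
  have s0: "0 \<le> s j" for j using n(1) by (simp add: s_def)
  \<comment> \<open>With \<open>q j\<close> the square of \<open>s j\<close>,
    \<open>(1 - q j)\<^sup>2\<close> factors as
    \<open>(1 - s j)\<^sup>2 * (1 + s j)\<^sup>2\<close>.\<close>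
  have "(A - B) * (1 - \<epsilon>) * (1 - s j)\<^sup>2 \<le> (1 - q j)\<^sup>2 * a j" for j
  proof -
    have "1 \<le> (1 + s j)\<^sup>2" using s0[of j] by (simp add: power2_eq_square algebra_simps)
    then have "(1 - s j)\<^sup>2 * 1 \<le> (1 - s j)\<^sup>2 * (1 + s j)\<^sup>2" by (intro mult_left_mono) auto
    also have "\<dots> = (1 - q j)\<^sup>2"
      using n(1)[of j] by (simp add: s_def algebra_simps flip: power_mult_distrib)
    finally have "(A - B) * (1 - \<epsilon>) * (1 - s j)\<^sup>2 \<le> a j * (1 - q j)\<^sup>2"
      using a_ge[of j] a0[of j] by (intro mult_mono) auto
    then show ?thesis by (simp add: mult.commute)
  qed
  then have "(\<Sum>j\<in>UNIV. (A - B) * (1 - \<epsilon>) * (1 - s j)\<^sup>2) \<le> (\<Sum>j\<in>UNIV. (1 - q j)\<^sup>2 * a j)"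
    by (rule sum_mono)
  then have main: "(A - B) * t + (A - B) * (1 - \<epsilon>) * (\<Sum>j\<in>UNIV. (1 - s j)\<^sup>2) \<le> \<delta>"
    using excess by (simp add: sum_distrib_left)
  \<comment> \<open>Bounding \<open>1 - \<epsilon>\<close> below by one half gives
    \<open>(1 - s j)\<^sup>2 \<le> 2 * \<epsilon> = \<eta>\<^sup>2\<close>; this explains the final
    division by 2 in \<open>\<epsilon>\<close>.\<close>
  have s: "s j \<le> 1 + \<eta>" for j
  proof -
    have "(A - B) * ((1 / 2) * (1 - s j)\<^sup>2) \<le> (A - B) * ((1 - \<epsilon>) * (\<Sum>j\<in>UNIV. (1 - s j)\<^sup>2))"
      using AB \<epsilon> by (intro mult_left_mono mult_mono member_le_sum) (auto simp: sum_nonneg)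
    also have "\<dots> \<le> (A - B) * \<epsilon>"
    proof -
      have "0 \<le> (A - B) * t" using AB t0 by simp
      then show ?thesis using main small by (simp add: \<epsilon>_def \<eta>_def mult.assoc)
    qed
    finally have "(1 - s j)\<^sup>2 \<le> \<eta>\<^sup>2" using AB by (simp add: \<epsilon>_def)
    then have "\<bar>1 - s j\<bar> \<le> \<eta>" using \<eta> by (simp add: abs_le_square_iff[symmetric])
    then show ?thesis by simp
  qed
  have t_lt: "t < 1" using t \<epsilon> by linarith
  obtain Z p where Z: "isometry (Z :: complex ^ 'm ^ 'm)"
    and p: "\<And>j. (conj_transpose u ** (coordinate_embedding g ** Z)) $ j $ j = complex_of_real (p j)"
    and p1: "\<And>j. p j \<le> 1" and ps: "(2 - t) * (\<Sum>j\<in>UNIV. 1 - p j) \<le> t"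
    using nearby_unitary[OF u g, folded t_def] t_lt by metis
  define S where "S = (\<Sum>j\<in>UNIV. (1 - s j)\<^sup>2)"
  define P where "P = (\<Sum>j\<in>UNIV. 1 - p j)"
  have P0: "0 \<le> P" unfolding P_def using p1 by (intro sum_nonneg) auto
  have S0: "0 \<le> S" unfolding S_def by (intro sum_nonneg) auto
  have Xu: "X = u ** diagonal s" using n(2) by (simp add: s_def[abs_def])
  have "(norm (X - coordinate_embedding g ** Z))\<^sup>2 = (\<Sum>j\<in>UNIV. (1 - s j)\<^sup>2 + 2 * s j * (1 - p j))"
    unfolding Xu by (rule norm_scaled_isometry_diff[OF u isometry_mult[OF isometry_coordinate_embedding[OF g] Z] p])
  also have "\<dots> \<le> (\<Sum>j\<in>UNIV. (1 - s j)\<^sup>2 + 2 * (1 + \<eta>) * (1 - p j))"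
    using p1 by (intro sum_mono add_mono mult_right_mono mult_left_mono s) auto
  also have "\<dots> = S + 2 * (1 + \<eta>) * P"
    by (simp add: S_def P_def sum.distrib sum_distrib_left)
  finally have nn: "(norm (X - coordinate_embedding g ** Z))\<^sup>2 \<le> S + 2 * (1 + \<eta>) * P" .
  have \<alpha>\<eta>: "\<alpha> * (1 + \<eta>) \<le> 1 - \<eta>"
  proof -
    have "\<alpha> * \<eta> \<le> 1 * \<eta>" using \<alpha> \<eta> by (intro mult_right_mono) auto
    moreover have "1 - \<eta> = \<alpha> + \<eta>" by (simp add: \<eta>_def field_simps)
    ultimately show ?thesis by (simp add: distrib_left)
  qed
  have "\<alpha> * (S + 2 * (1 + \<eta>) * P) = \<alpha> * S + 2 * (\<alpha> * (1 + \<eta>)) * P" by (simp add: algebra_simps)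
  also have "\<dots> \<le> (1 - \<epsilon>) * S + (2 - t) * P"
  proof -
    have "\<alpha> \<le> 1 - \<epsilon>" using \<epsilon>(2) \<alpha> by (simp add: \<eta>_def field_simps)
    moreover have "2 * (\<alpha> * (1 + \<eta>)) \<le> 2 - t" using \<alpha>\<eta> \<epsilon> t by linarith
    ultimately show ?thesis using S0 P0 by (intro add_mono mult_right_mono) auto
  qed
  also have "\<dots> \<le> (1 - \<epsilon>) * S + t" using ps by (simp add: P_def)
  finally have "(A - B) * (\<alpha> * (S + 2 * (1 + \<eta>) * P)) \<le> (A - B) * ((1 - \<epsilon>) * S + t)"
    using AB by (intro mult_left_mono) auto
  also have "\<dots> \<le> \<delta>" using main by (simp add: S_def algebra_simps)
  finally have "(A - B) * (\<alpha> * (S + 2 * (1 + \<eta>) * P)) \<le> \<delta>" .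
  moreover have "\<alpha> * (A - B) * (norm (X - coordinate_embedding g ** Z))\<^sup>2
      \<le> \<alpha> * (A - B) * (S + 2 * (1 + \<eta>) * P)"
    using nn \<alpha> AB by (intro mult_left_mono) auto
  ultimately show ?thesis using Z by (intro exI[of _ Z]) (simp add: mult_ac)
qed

section \<open>Return to general matrices and the bound for the minimizers\<close>

text \<open>Cauchy-Schwarz against the constant 1 on all entries; this is the source of the square
  root in the final bound.\<close>

lemma sum_cmod_le_norm:
  "(\<Sum>i\<in>UNIV. \<Sum>j\<in>UNIV. cmod (X $ i $ j)) \<le> sqrt (real (CARD('n) * CARD('m))) * norm X"
  for X :: "complex ^ 'm ^ 'n"
proof -
  define f where "f = (\<lambda>(i, j). cmod (X $ i $ j))"
  have "(\<Sum>i\<in>UNIV. \<Sum>j\<in>UNIV. cmod (X $ i $ j)) = (\<Sum>p\<in>UNIV \<times> UNIV. f p)"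
    by (simp only: sum.cartesian_product f_def)
  also have "\<dots> \<le> sqrt ((\<Sum>p\<in>UNIV \<times> UNIV. (f p)\<^sup>2) * real (card (UNIV \<times> UNIV :: ('n \<times> 'm) set)))"
    by (rule real_le_rsqrt, rule sum_squared_le_sum_of_squares)
  also have "(\<Sum>p\<in>UNIV \<times> UNIV. (f p)\<^sup>2) = (norm X)\<^sup>2"
    unfolding frobenius_norm_sum by (subst sum.swap) (simp add: f_def sum.cartesian_product case_prod_unfold)
  finally show ?thesis by (simp add: real_sqrt_mult card_cartesian_product mult.commute del: UNIV_Times_UNIV)
qed

text \<open>Passing to eigenbases of \<open>H\<close> and of the Gram matrix of \<open>X\<close>
  reduces both claims to the diagonal case. The second basis, and with it \<open>Y\<close>, depends
  on \<open>X\<close>; the deviation asks for just one \<open>Y\<close> per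
  \<open>X\<close>.\<close>

lemma energy0_quadratic_growth:
  fixes H V :: "complex ^ 'n ^ 'n" and X :: "complex ^ 'm ^ 'n" and g :: "'m::finite \<Rightarrow> 'n::finite"
    and k :: "'n \<Rightarrow> real"
  assumes V: "isometry V" and H: "conj_transpose V ** H ** V = diagonal k" and g: "inj g"
    and lo: "\<And>j. k (g j) \<le> - A" and hi: "\<And>i. i \<notin> range g \<Longrightarrow> - B \<le> k i"
    and B: "0 \<le> B" and AB: "B < A" and k: "\<And>i. k i \<le> 0"
    and \<alpha>: "0 < \<alpha>" "\<alpha> < 1"
  defines "e \<equiv> \<Sum>j\<in>UNIV. k (g j)"
  shows "e \<le> energy0 H X"
    and "energy0 H X - e \<le> (A - B) * (((1 - \<alpha>) / 2)\<^sup>2 / 2) \<Longrightarrow>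
      \<exists>Y. energy0 H Y = e \<and> \<alpha> * (A - B) * (norm (X - Y))\<^sup>2 \<le> energy0 H X - e"
proof -
  obtain W :: "complex ^ 'm ^ 'm" and q where W: "isometry W"
    and q: "conj_transpose W ** (conj_transpose X ** X) ** W = diagonal q"
    using hermitian_diagonalization[OF hermitian_gram] by metis
  define X' where "X' = conj_transpose V ** X ** W"
  have gram: "conj_transpose X' ** X' = diagonal q"
    unfolding X'_def gram_isometry_mult[OF isometry_conj_transpose[OF V]] by (rule q)
  have "X = (V ** conj_transpose V) ** X ** (W ** conj_transpose W)"
    using V W by (simp add: isometry_right_inverse)
  then have X: "X = V ** X' ** conj_transpose W"
    by (simp only: X'_def matrix_mul_assoc)
  have energy: "energy0 H (V ** Y ** conj_transpose W) = energy0 (diagonal k) Y" for Y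
    using energy0_unitary_mult[OF V isometry_conj_transpose[OF W]] H by metis
  have eX: "energy0 H X = energy0 (diagonal k) X'" by (subst X) (rule energy)
  show "e \<le> energy0 H X"
  proof -
    note ex = energy_excess[where k = k and g = g and A = A and B = B, OF gram g lo hi B, folded eX e_def]
    have "0 \<le> (A - B) * (real CARD('m) - (\<Sum>l\<in>UNIV. \<Sum>j\<in>UNIV.
        (cmod ((X' ** diagonal (\<lambda>j. inverse (sqrt (q j)))) $ g l $ j))\<^sup>2))"
      using ex(1) AB by (intro mult_nonneg_nonneg) auto
    moreover have "0 \<le> (\<Sum>j\<in>UNIV. (1 - q j)\<^sup>2 * (\<Sum>i\<in>UNIV.
        - k i * (cmod ((X' ** diagonal (\<lambda>j. inverse (sqrt (q j)))) $ i $ j))\<^sup>2))"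
      using k by (intro sum_nonneg mult_nonneg_nonneg) auto
    ultimately show ?thesis using ex(2) by linarith
  qed
  assume "energy0 H X - e \<le> (A - B) * (((1 - \<alpha>) / 2)\<^sup>2 / 2)"
  then obtain Z where Z: "isometry Z"
    and growth: "\<alpha> * (A - B) * (norm (X' - coordinate_embedding g ** Z))\<^sup>2 \<le> energy0 H X - e"
    using quadratic_growth_diagonal[where k = k and g = g and A = A and B = B, OF gram g lo hi B AB k \<alpha>, folded eX e_def]
    by metis
  define Y where "Y = V ** (coordinate_embedding g ** Z) ** conj_transpose W"
  have "X - Y = V ** (X' - coordinate_embedding g ** Z) ** conj_transpose W"
    by (subst X) (simp only: Y_def matrix_diff_ldistrib matrix_diff_rdistrib)
  then have "norm (X - Y) = norm (X' - coordinate_embedding g ** Z)"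
    using norm_unitary_mult[OF V isometry_conj_transpose[OF W]] by metis
  moreover have "energy0 H Y = e"
    unfolding Y_def energy e_def by (rule energy0_coordinate_embedding[OF g Z])
  ultimately show "\<exists>Y. energy0 H Y = e \<and> \<alpha> * (A - B) * (norm (X - Y))\<^sup>2 \<le> energy0 H X - e"
    using growth by metis
qed

theorem theorem3:
  fixes H :: "complex ^ 'n ^ 'n"
    and lam :: "nat \<Rightarrow> real"
    and \<alpha> :: real
  assumes "CARD('m::finite) < CARD('n)"
    and "hermitian_neg_def H"
    and "ordered_eigenvalues H lam"
    and "lam CARD('n) < 0"
    and "0 < \<alpha>" and "\<alpha> < 1"
    and "lam CARD('m) < lam (CARD('m) + 1)"
  shows "\<exists>\<mu>\<^sub>0 > 0. \<forall>\<mu>. 0 < \<mu> \<and> \<mu> < \<mu>\<^sub>0 \<longrightarrow>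
    set_deviation (minimizers H \<mu> :: (complex ^ 'm ^ 'n) set) (minimizers H 0)
      \<le> ereal (\<mu> * sqrt (real (CARD('n) * CARD('m)))
                / (\<alpha> * (lam (CARD('m) + 1) - lam CARD('m))))"
proof -
  define m where "m = CARD('m)"
  define \<gamma> where "\<gamma> = lam (m + 1) - lam m"
  have m: "0 < m" "m < CARD('n)" using assms(1) by (simp_all add: m_def)
  have gap: "lam m < lam (m + 1)" using assms(7) by (simp add: m_def)
  have "hermitian H" using assms(2) by (simp add: hermitian_neg_def_def)
  then obtain V :: "complex ^ 'n ^ 'n" and k where V: "isometry V" and H: "conj_transpose V ** H ** V = diagonal k"
    by (rule hermitian_diagonalization)
  note split = ordered_eigenvalues_split[OF assms(3) V H m gap]
  \<comment> \<open>The gap gives exactly \<open>CARD('m)\<close> low eigendirections, so they can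
    be indexed by the column type itself.\<close>
  obtain g :: "'m \<Rightarrow> 'n" where "bij_betw g UNIV {i. k i \<le> lam m}"
    using split(1) by (metis finite finite_same_card_bij m_def)
  then have g: "inj g" and range_g: "range g = {i. k i \<le> lam m}"
    by (simp_all add: bij_betw_def)
  \<comment> \<open>The growth lemma is used with \<open>A = - lam m\<close> and
    \<open>B = - lam (m + 1)\<close>, so that \<open>A - B\<close> is the gap
    \<open>\<gamma>\<close>; the double negations match its form.\<close>
  have lo: "k (g j) \<le> - (- lam m)" for j using range_g by auto
  have hi: "- (- lam (m + 1)) \<le> k i" if "i \<notin> range g" for i
    using split(2)[of i] that range_g by simp
  have k: "k i \<le> 0" for i using split(3)[of i] assms(4) by linarith
  have "lam (m + 1) \<le> lam CARD('n)"
    using assms(3) m by (auto simp: ordered_eigenvalues_def mono_on_def)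
  then have B: "0 \<le> - lam (m + 1)" using assms(4) by simp
  have AB: "- lam (m + 1) < - lam m" using gap by simp
  have \<gamma>: "- lam m - - lam (m + 1) = \<gamma>" "0 < \<gamma>" using gap by (simp_all add: \<gamma>_def)
  define e where "e = (\<Sum>j\<in>UNIV. k (g j))"
  define \<epsilon> where "\<epsilon> = \<gamma> * (((1 - \<alpha>) / 2)\<^sup>2 / 2)"
  have \<epsilon>: "0 < \<epsilon>" using \<gamma>(2) assms(5,6) by (simp add: \<epsilon>_def)
  note growth = energy0_quadratic_growth[where k = k and g = g and A = "- lam m" and B = "- lam (m + 1)",
    OF V H g lo hi B AB k assms(5,6), unfolded \<gamma>(1), folded e_def \<epsilon>_def]
  define l1 where "l1 X = (\<Sum>i\<in>UNIV. \<Sum>j\<in>UNIV. cmod (X $ i $ j))" for X :: "complex ^ 'm ^ 'n"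
  have energy: "energy H \<mu> X = energy0 H X + \<mu> * l1 X" for \<mu> and X :: "complex ^ 'm ^ 'n"
    by (simp add: energy_def l1_def)
  define Y0 where "Y0 = V ** (coordinate_embedding g ** (mat 1 :: complex ^ 'm ^ 'm)) ** mat 1"
  have Y0: "energy0 H Y0 = e"
    unfolding Y0_def e_def
    by (subst energy0_unitary_mult[OF V], simp add: isometry_def, subst H,
        rule energy0_coordinate_embedding[OF g], simp add: isometry_def)
  \<comment> \<open>Chosen so that \<open>\<mu> * l1 Y0 \<le> \<epsilon>\<close>; the summand 1
    keeps the denominator positive.\<close>
  define \<mu>\<^sub>0 where "\<mu>\<^sub>0 = \<epsilon> / (l1 Y0 + 1)"
  have l1Y0: "0 \<le> l1 Y0" by (simp add: l1_def sum_nonneg)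
  have bound: "\<exists>Y\<in>minimizers H 0. norm (X - Y) \<le> \<mu> * sqrt (real (CARD('n) * CARD('m))) / (\<alpha> * \<gamma>)"
    if \<mu>: "0 < \<mu>" "\<mu> < \<mu>\<^sub>0" and X: "X \<in> minimizers H \<mu>" for \<mu> and X :: "complex ^ 'm ^ 'n"
  proof -
    have le: "energy0 H X + \<mu> * l1 X \<le> energy0 H Y + \<mu> * l1 Y" for Y
      using X by (simp add: minimizers_def energy)
    have "0 \<le> \<mu> * l1 X" using \<mu> by (simp add: l1_def sum_nonneg)
    \<comment> \<open>A crude comparison with the fixed \<open>Y0\<close> brings \<open>X\<close>
      into the region where quadratic growth holds; the \<open>Y\<close> found there then gives the
      sharp comparison.\<close>
    then have "energy0 H X - e \<le> \<mu> * l1 Y0" using le[of Y0] Y0 by simp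
    also have "\<dots> \<le> \<mu>\<^sub>0 * (l1 Y0 + 1)" using \<mu> l1Y0 by (intro mult_mono) auto
    also have "\<dots> = \<epsilon>" using l1Y0 by (simp add: \<mu>\<^sub>0_def)
    finally obtain Y where Y: "energy0 H Y = e" "\<alpha> * \<gamma> * (norm (X - Y))\<^sup>2 \<le> energy0 H X - e"
      using growth(2) by blast
    have "Y \<in> minimizers H 0"
      using growth(1) Y(1) by (simp add: minimizers_def energy)
    moreover have "norm (X - Y) \<le> \<mu> * sqrt (real (CARD('n) * CARD('m))) / (\<alpha> * \<gamma>)"
    proof (cases "norm (X - Y) = 0")
      case True
      then show ?thesis using \<mu> \<gamma>(2) assms(5) by simp
    next
      case False
      \<comment> \<open>The upper bound on the excess is linear in \<open>norm (X - Y)\<close> and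
        the lower bound quadratic, so one factor \<open>norm (X - Y)\<close> cancels.\<close>
      have "l1 Y - l1 X \<le> l1 (X - Y)"
        unfolding l1_def sum_subtractf[symmetric]
        by (intro sum_mono) (metis norm_minus_commute norm_triangle_ineq2 vector_minus_component)
      then have "\<mu> * (l1 Y - l1 X) \<le> \<mu> * (sqrt (real (CARD('n) * CARD('m))) * norm (X - Y))"
        using \<mu> sum_cmod_le_norm[of "X - Y"] by (intro mult_left_mono) (auto simp: l1_def)
      moreover have "energy0 H X - e \<le> \<mu> * (l1 Y - l1 X)"
        using le[of Y] Y(1) by (simp add: right_diff_distrib)
      ultimately have "(\<alpha> * \<gamma> * norm (X - Y)) * norm (X - Y)
          \<le> (\<mu> * sqrt (real (CARD('n) * CARD('m)))) * norm (X - Y)"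
        using Y(2) by (simp add: power2_eq_square mult_ac)
      then have "\<alpha> * \<gamma> * norm (X - Y) \<le> \<mu> * sqrt (real (CARD('n) * CARD('m)))"
        using False by (simp add: mult_le_cancel_right)
      then show ?thesis using \<gamma>(2) assms(5) by (simp add: pos_le_divide_eq mult_ac)
    qed
    ultimately show ?thesis by blast
  qed
  show ?thesis
  proof (intro exI[of _ \<mu>\<^sub>0] conjI allI impI)
    show "0 < \<mu>\<^sub>0" using \<epsilon> l1Y0 by (simp add: \<mu>\<^sub>0_def)
    fix \<mu> assume \<mu>: "0 < \<mu> \<and> \<mu> < \<mu>\<^sub>0"
    show "set_deviation (minimizers H \<mu> :: (complex ^ 'm ^ 'n) set) (minimizers H 0)
      \<le> ereal (\<mu> * sqrt (real (CARD('n) * CARD('m))) / (\<alpha> * (lam (CARD('m) + 1) - lam CARD('m))))"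
      unfolding set_deviation_def
    proof (rule SUP_least)
      fix X :: "complex ^ 'm ^ 'n" assume "X \<in> minimizers H \<mu>"
      then obtain Y where "Y \<in> minimizers H 0"
        "norm (X - Y) \<le> \<mu> * sqrt (real (CARD('n) * CARD('m))) / (\<alpha> * \<gamma>)"
        using bound \<mu> by blast
      then show "(INF Y\<in>minimizers H 0. ereal (norm (X - Y)))
          \<le> ereal (\<mu> * sqrt (real (CARD('n) * CARD('m))) / (\<alpha> * (lam (CARD('m) + 1) - lam CARD('m))))"
        by (intro INF_lower2[of Y]) (simp_all add: \<gamma>_def m_def)
    qed
  qed
qed

end
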